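(* Let $F\in\mathcal P_d$ form an $(h,\kappa,\eta,m,M)$-regular cluster. Then for each positive $\epsilon\le\left(\frac{h}{1+|\kappa|}\right)^{2d-1}R$, $$\rho(F,\epsilon)\le C_4\left(\frac{1+|\kappa|}h\right)^{2d-1}\epsilon,\qquad \rho_a(F,\epsilon)\le C_4\left(\frac{1+|\kappa|}h\right)^{2d-1}\epsilon,\qquad \rho_x(F,\epsilon)\le C_4\left(\frac{1+|\kappa|}h\right)^{2d-1}h\,\epsilon,$$ where $R,C_4>0$ are the constants, depending only on $d,\eta,m,M$, described in the context.
   Context: Let $d\ge2$. $\mathcal P_d$ is the set of $F=(a,x)\in\mathbb R^d\times\mathbb R^d$ with $x_1<\dots<x_d$ and all $a_j\ne0$; $F$ is identified with $F(x)=\sum_j a_j\delta(x-x_j)$. Moments: $m_k(F)=\sum_{j=1}^d a_jx_j^k$. All norms are maximum norms: $\|F\|=\max(\|a\|,\|x\|)$, $\|v\|=\max_j|v_j|$. Put $h(F)=\frac12(x_d-x_1)$, $\kappa(F)=\frac12(x_1+x_d)$. For $0<m\le M$ and $\eta>0$, $F$ forms an $(h,\kappa,\eta,m,M)$-regular cluster if $h=h(F)\le\frac12$, $\kappa=\kappa(F)$, $m\le|a_j|\le M$ for all $j$, and $x_{j+1}-x_j\ge\eta h$ for $j=1,\dots,d-1$. Error set: $E_\epsilon(F)=\{F'\in\mathcal P_d: |m_k(F')-m_k(F)|\le\epsilon,\ k=0,\dots,2d-1\}$. Worst case reconstruction errors of $F=(a,x)$: $\rho(F,\epsilon)=\max_{F'\in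 E_\epsilon(F)}\|F'-F\|$, $\rho_a(F,\epsilon)=\max_{F'=(a',x')\in E_\epsilon(F)}\|a'-a\|$, $\rho_x(F,\epsilon)=\max_{F'=(a',x')\in E_\epsilon(F)}\|x'-x\|$. Constants: let $PM:\mathcal P_d\to\mathbb R^{2d}$, $PM(F)=(m_0(F),\dots,m_{2d-1}(F))$, and $Q_R(\nu)=\{\nu':\|\nu'-\nu\|\le R\}$. A signal in $\mathcal P_d$ is $(\eta,m,M)$-regular if its nodes lie in $[-1,1]$, neighboring nodes are at distance at least $\eta$, and its amplitudes satisfy $m\le|a_j|\le M$. The positive constants $R,C_3,C_4$, depending only on $d,\eta,m,M$, are such that for every $(\eta,m,M)$-regular $G$ with $\nu=PM(G)$, the inverse $PM^{-1}$ exists on $Q_R(\nu)$, is a diffeomorphism of $Q_R(\nu)$ onto $PM^{-1}(Q_R(\nu))$, and $C_3\|\nu''-\nu'\|\le\|PM^{-1}(\nu'')-PM^{-1}(\nu')\|\le C_4\|\nu''-\nu'\|$ for all $\nu',\nu''\in Q_R(\nu)$ (such constants exist). *)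

theory Defs
  imports "HOL-Analysis.Analysis"
begin

text \<open>
  The dimension \<open>d\<close> is \<open>CARD('d)\<close> for a finite linearly ordered index type \<open>'d\<close>, whose order
  realises the indexing \<open>1 < \<dots> < d\<close>. A signal \<open>F = (a, x)\<close> is a pair of vectors. The maximum
  norm is \<^const>\<open>infnorm\<close>; the two lemmas below confirm its meaning on vectors and on pairs.
\<close>

type_synonym 'd signal = "(real ^ 'd) \<times> (real ^ 'd)"

lemma infnorm_vec_eq_Max:
  fixes v :: "real ^ 'n"
  shows "infnorm v = Max (range (\<lambda>j. \<bar>v $ j\<bar>))"
proof -
  have "infnorm v = Sup (range (\<lambda>j. \<bar>v $ j\<bar>))"
    by (simp add: infnorm_cart full_SetCompr_eq)
  then show ?thesis
    by (simp add: cSup_eq_Max)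
qed

lemma infnorm_Pair_eq_max:
  fixes a :: "real ^ 'm" and x :: "real ^ 'n"
  shows "infnorm (a, x) = max (infnorm a) (infnorm x)"
proof -
  have "(\<lambda>b. \<bar>(a, x) \<bullet> b\<bar>) ` Basis = (\<lambda>b. \<bar>a \<bullet> b\<bar>) ` Basis \<union> (\<lambda>b. \<bar>x \<bullet> b\<bar>) ` Basis"
    by (auto simp: Basis_prod_def image_Un image_image)
  then show ?thesis
    by (simp add: infnorm_Max Max_Un)
qed

abbreviation amps :: "'d signal \<Rightarrow> real ^ 'd" where "amps \<equiv> fst"
abbreviation nodes :: "'d signal \<Rightarrow> real ^ 'd" where "nodes \<equiv> snd"

definition signals :: "'d::{finite,linorder} signal set" where
  "signals = {F. strict_mono (\<lambda>j. nodes F $ j) \<and> (\<forall>j. amps F $ j \<noteq> 0)}"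

definition moment :: "nat \<Rightarrow> 'd::finite signal \<Rightarrow> real" where
  "moment k F = (\<Sum>j\<in>UNIV. amps F $ j * (nodes F $ j) ^ k)"

definition half_width :: "'d::{finite,linorder} signal \<Rightarrow> real" where
  "half_width F = (nodes F $ Max UNIV - nodes F $ Min UNIV) / 2"

definition center :: "'d::{finite,linorder} signal \<Rightarrow> real" where
  "center F = (nodes F $ Min UNIV + nodes F $ Max UNIV) / 2"

definition next_index :: "'d::linorder \<Rightarrow> 'd \<Rightarrow> bool" where
  "next_index i j \<longleftrightarrow> i < j \<and> {i<..<j} = {}"

definition regular_cluster ::
    "real \<Rightarrow> real \<Rightarrow> real \<Rightarrow> real \<Rightarrow> real \<Rightarrow> 'd::{finite,linorder} signal \<Rightarrow> bool" where
  "regular_cluster h \<kappa> \<eta> m M F \<longleftrightarrow>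
     F \<in> signals \<and> h = half_width F \<and> h \<le> 1 / 2 \<and> \<kappa> = center F \<and>
     (\<forall>j. m \<le> \<bar>amps F $ j\<bar> \<and> \<bar>amps F $ j\<bar> \<le> M) \<and>
     (\<forall>i j. next_index i j \<longrightarrow> nodes F $ j - nodes F $ i \<ge> \<eta> * h)"

definition regular_signal ::
    "real \<Rightarrow> real \<Rightarrow> real \<Rightarrow> 'd::{finite,linorder} signal \<Rightarrow> bool" where
  "regular_signal \<eta> m M G \<longleftrightarrow>
     G \<in> signals \<and> (\<forall>j. nodes G $ j \<in> {-1..1}) \<and>
     (\<forall>i j. next_index i j \<longrightarrow> nodes G $ j - nodes G $ i \<ge> \<eta>) \<and>
     (\<forall>j. m \<le> \<bar>amps G $ j\<bar> \<and> \<bar>amps G $ j\<bar> \<le> M)"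

definition error_set :: "real \<Rightarrow> 'd::{finite,linorder} signal \<Rightarrow> 'd signal set" where
  "error_set \<epsilon> F =
     {F' \<in> signals. \<forall>k \<in> {0..2 * CARD('d) - 1}. \<bar>moment k F' - moment k F\<bar> \<le> \<epsilon>}"

text \<open>
  The worst case errors are genuine maxima: \<open>GREATEST\<close> denotes the largest attained value, and is
  unspecified if no such value exists.
\<close>

definition worst_error :: "'d::{finite,linorder} signal \<Rightarrow> real \<Rightarrow> real" where
  "worst_error F \<epsilon> = (GREATEST r. \<exists>F' \<in> error_set \<epsilon> F. r = infnorm (F' - F))"

definition worst_amp_error :: "'d::{finite,linorder} signal \<Rightarrow> real \<Rightarrow> real" where
  "worst_amp_error F \<epsilon> = (GREATEST r. \<exists>F' \<in> error_set \<epsilon> F. r = infnorm (amps F' - amps F))"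

definition worst_node_error :: "'d::{finite,linorder} signal \<Rightarrow> real \<Rightarrow> real" where
  "worst_node_error F \<epsilon> = (GREATEST r. \<exists>F' \<in> error_set \<epsilon> F. r = infnorm (nodes F' - nodes F))"

text \<open>
  The type \<open>'d bit0\<close> has \<open>2 * CARD('d)\<close> elements, represented by \<open>Rep_bit0\<close> as the integers
  \<open>0, \<dots>, 2 * CARD('d) - 1\<close>; hence \<open>real ^ 'd bit0\<close> is the space of moment vectors.
\<close>

definition PM :: "'d::finite signal \<Rightarrow> real ^ 'd bit0" where
  "PM F = (\<chi> k. moment (nat (Rep_bit0 k)) F)"

definition PM_inv :: "real ^ 'd bit0 \<Rightarrow> 'd::{finite,linorder} signal" where
  "PM_inv = inv_into signals PM"

definition cube :: "real \<Rightarrow> 'a::euclidean_space \<Rightarrow> 'a set" where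
  "cube R \<nu> = {\<nu>'. infnorm (\<nu>' - \<nu>) \<le> R}"

definition C1_on :: "'a::real_normed_vector set \<Rightarrow> ('a \<Rightarrow> 'b::real_normed_vector) \<Rightarrow> bool" where
  "C1_on S f \<longleftrightarrow>
     (\<exists>f'. (\<forall>x\<in>S. (f has_derivative blinfun_apply (f' x)) (at x within S)) \<and> continuous_on S f')"

definition diffeomorphism_on ::
    "'a::real_normed_vector set \<Rightarrow> 'b::real_normed_vector set \<Rightarrow> ('a \<Rightarrow> 'b) \<Rightarrow> bool" where
  "diffeomorphism_on S T f \<longleftrightarrow> bij_betw f S T \<and> C1_on S f \<and> C1_on T (inv_into S f)"

text \<open>
  The property of the constants \<open>R\<close>, \<open>C\<^sub>3\<close>, \<open>C\<^sub>4\<close> at one signal \<open>G\<close>. The unique existence clause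
  says that \<open>PM\<close> is invertible on the cube, so that \<^const>\<open>PM_inv\<close> is the true inverse there.
\<close>

definition bilipschitz_inverse_at ::
    "real \<Rightarrow> real \<Rightarrow> real \<Rightarrow> 'd::{finite,linorder} signal \<Rightarrow> bool" where
  "bilipschitz_inverse_at R C\<^sub>3 C\<^sub>4 G \<longleftrightarrow>
     (\<forall>\<nu>' \<in> cube R (PM G). \<exists>!F. F \<in> signals \<and> PM F = \<nu>') \<and>
     diffeomorphism_on (cube R (PM G)) {F \<in> signals. PM F \<in> cube R (PM G)} PM_inv \<and>
     (\<forall>\<nu>' \<in> cube R (PM G). \<forall>\<nu>'' \<in> cube R (PM G).
        C\<^sub>3 * infnorm (\<nu>'' - \<nu>') \<le> infnorm (PM_inv \<nu>'' - PM_inv \<nu>') \<and>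
        infnorm (PM_inv \<nu>'' - PM_inv \<nu>') \<le> C\<^sub>4 * infnorm (\<nu>'' - \<nu>'))"

end

theory Submission
  imports Defs
begin

text \<open>
  The affine map \<open>t \<mapsto> (t - \<kappa>) / h\<close> sends the cluster \<open>F\<close> to a regular signal \<open>G\<close> with nodes
  spread over \<open>[-1, 1]\<close>. By the binomial formula it enlarges differences of the first \<open>2 d\<close> moments
  by a factor of at most \<open>((1 + \<bar>\<kappa>\<bar>) / h) ^ (2 d - 1)\<close>, so the whole error set of \<open>F\<close> lands in the
  region around \<open>G\<close> on which \<open>PM\<close> has a \<open>C\<^sub>4\<close>-Lipschitz inverse. Scaling back leaves the amplitudes
  alone and multiplies the node errors by \<open>h\<close>. The error set is a continuous image of a compact set
  of moment vectors, so the maxima defining the worst case errors are attained.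
\<close>

section \<open>Affine pushforward of signals and its effect on moments\<close>

definition affine_nodes :: "real \<Rightarrow> real \<Rightarrow> 'd::finite signal \<Rightarrow> 'd signal" where
  "affine_nodes s c F = (amps F, \<chi> j. s * nodes F $ j + c)"

lemma amps_affine_nodes [simp]: "amps (affine_nodes s c F) = amps F"
  and nodes_affine_nodes [simp]: "nodes (affine_nodes s c F) $ j = s * nodes F $ j + c"
  by (simp_all add: affine_nodes_def)

lemma affine_nodes_compose:
  "affine_nodes s c (affine_nodes s' c' F) = affine_nodes (s * s') (s * c' + c) F"
  by (simp add: affine_nodes_def algebra_simps)

lemma affine_nodes_id [simp]: "affine_nodes 1 0 F = F"
  by (simp add: affine_nodes_def)

lemma affine_nodes_in_signals:
  "0 < s \<Longrightarrow> F \<in> signals \<Longrightarrow> affine_nodes s c F \<in> signals"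
  by (simp add: signals_def strict_mono_def)

lemma continuous_on_affine_nodes [continuous_intros]:
  "continuous_on S f \<Longrightarrow> continuous_on S (\<lambda>x. affine_nodes s c (f x))"
  unfolding affine_nodes_def by (intro continuous_intros)

lemma continuous_on_moment [continuous_intros]:
  "continuous_on S f \<Longrightarrow> continuous_on S (\<lambda>x. moment k (f x))"
  unfolding moment_def by (intro continuous_intros)

text \<open>Expand \<open>(s * x + c) ^ k\<close> under the sum. The expansion is triangular: the
  first \<open>2 d\<close> moments of the image involve only the first \<open>2 d\<close> moments of
  the original.\<close>

lemma moment_affine_nodes:
  "moment k (affine_nodes s c F) = (\<Sum>i\<le>k. of_nat (k choose i) * s ^ i * c ^ (k - i) * moment i F)"
proof -
  have "moment k (affine_nodes s c F) =
      (\<Sum>j\<in>UNIV. \<Sum>i\<le>k. of_nat (k choose i) * s ^ i * c ^ (k - i) * (amps F $ j * nodes F $ j ^ i))"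
    by (simp add: moment_def binomial_ring power_mult_distrib sum_distrib_left mult_ac)
  also have "\<dots> = (\<Sum>i\<le>k. of_nat (k choose i) * s ^ i * c ^ (k - i) * moment i F)"
    by (subst sum.swap) (simp add: moment_def sum_distrib_left)
  finally show ?thesis .
qed

text \<open>The absolute values of the binomial coefficients in \<open>moment_affine_nodes\<close>
  sum to \<open>(\<bar>s\<bar> + \<bar>c\<bar>) ^ k\<close>.\<close>

lemma moment_affine_nodes_diff_le:
  assumes "\<And>i. i \<le> k \<Longrightarrow> \<bar>moment i F' - moment i F\<bar> \<le> \<epsilon>"
  shows "\<bar>moment k (affine_nodes s c F') - moment k (affine_nodes s c F)\<bar> \<le> (\<bar>s\<bar> + \<bar>c\<bar>) ^ k * \<epsilon>"
proof -
  have "\<bar>moment k (affine_nodes s c F') - moment k (affine_nodes s c F)\<bar>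
      = \<bar>\<Sum>i\<le>k. of_nat (k choose i) * s ^ i * c ^ (k - i) * (moment i F' - moment i F)\<bar>"
    by (simp add: moment_affine_nodes sum_subtractf right_diff_distrib)
  also have "\<dots> \<le> (\<Sum>i\<le>k. \<bar>of_nat (k choose i) * s ^ i * c ^ (k - i) * (moment i F' - moment i F)\<bar>)"
    by (rule sum_abs)
  also have "\<dots> \<le> (\<Sum>i\<le>k. of_nat (k choose i) * \<bar>s\<bar> ^ i * \<bar>c\<bar> ^ (k - i) * \<epsilon>)"
    by (intro sum_mono) (auto simp: abs_mult power_abs intro!: mult_left_mono assms)
  also have "\<dots> = (\<bar>s\<bar> + \<bar>c\<bar>) ^ k * \<epsilon>"
    by (simp add: binomial_ring sum_distrib_right)
  finally show ?thesis .
qed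

section \<open>Maximum norm, moment vectors and attained maxima\<close>

lemma infnorm_vec_le_iff:
  fixes v :: "real ^ 'n"
  shows "infnorm v \<le> B \<longleftrightarrow> (\<forall>j. \<bar>v $ j\<bar> \<le> B)"
  by (simp add: infnorm_vec_eq_Max)

lemma infnorm_signal:
  fixes F :: "'d::finite signal"
  shows "infnorm F = max (infnorm (amps F)) (infnorm (nodes F))"
  using infnorm_Pair_eq_max[of "amps F" "nodes F"] by simp

lemma infnorm_PM_diff_le:
  fixes F F' :: "'d::finite signal"
  assumes "\<And>k. k \<le> 2 * CARD('d) - 1 \<Longrightarrow> \<bar>moment k F' - moment k F\<bar> \<le> B"
  shows "infnorm (PM F' - PM F) \<le> B"
  unfolding infnorm_vec_le_iff
proof
  fix k :: "'d bit0"
  have "Rep_bit0 k \<in> {0..<2 * int CARD('d)}"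
    by (rule Rep_bit0)
  then have "nat (Rep_bit0 k) \<le> 2 * CARD('d) - 1"
    by auto
  then show "\<bar>(PM F' - PM F) $ k\<bar> \<le> B"
    using assms by (simp add: PM_def)
qed

lemma continuous_on_infnorm_comp [continuous_intros]:
  "continuous_on S f \<Longrightarrow> continuous_on S (\<lambda>x. infnorm (f x))"
  unfolding continuous_on_def by (auto intro: tendsto_infnorm)

lemma compact_cube: "compact (cube R \<nu>)"
proof (rule compact_eq_bounded_closed[THEN iffD2, OF conjI])
  show "bounded (cube R \<nu>)"
  proof (rule bounded_subset[OF bounded_cball])
    show "cube R \<nu> \<subseteq> cball \<nu> (sqrt DIM('a) * R)"
      by (auto simp: cube_def dist_norm norm_minus_commute
          intro!: order_trans[OF norm_le_infnorm] mult_left_mono)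
  qed
  show "closed (cube R \<nu>)"
    unfolding cube_def by (intro closed_Collect_le continuous_intros)
qed

text \<open>\<open>GREATEST\<close> is unspecified unless a largest value exists, so bounding all
  values is not enough; compactness supplies a maximizer.\<close>

lemma Greatest_le_of_compact:
  fixes f :: "'a::topological_space \<Rightarrow> real"
  assumes "compact S" "S \<noteq> {}" "continuous_on S f" "\<And>x. x \<in> S \<Longrightarrow> f x \<le> B"
  shows "(GREATEST r. \<exists>x\<in>S. r = f x) \<le> B"
proof -
  obtain y where "y \<in> S" "\<And>x. x \<in> S \<Longrightarrow> f x \<le> f y"
    using continuous_attains_sup assms(1-3) by metis
  then have "(GREATEST r. \<exists>x\<in>S. r = f x) = f y"
    by (intro Greatest_equality) auto
  then show ?thesis
    using assms(4) \<open>y \<in> S\<close> by simp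
qed

text \<open>Since \<open>infnorm\<close> \<le> \<open>norm\<close> \<le>
  \<open>sqrt DIM * infnorm\<close>, passing to Euclidean norms costs only the factor
  \<open>sqrt DIM('b)\<close>.\<close>

lemma continuous_on_of_infnorm_lipschitz:
  fixes f :: "'a::euclidean_space \<Rightarrow> 'b::euclidean_space"
  assumes "0 < C" "\<And>x y. x \<in> S \<Longrightarrow> y \<in> S \<Longrightarrow> infnorm (f y - f x) \<le> C * infnorm (y - x)"
  shows "continuous_on S f"
proof (rule lipschitz_on_continuous_on)
  show "(sqrt DIM('b) * C)-lipschitz_on S f"
  proof (rule lipschitz_onI)
    fix x y assume "x \<in> S" "y \<in> S"
    have "norm (f x - f y) \<le> sqrt DIM('b) * infnorm (f x - f y)"
      by (rule norm_le_infnorm)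
    also have "\<dots> \<le> sqrt DIM('b) * (C * norm (x - y))"
      using assms \<open>x \<in> S\<close> \<open>y \<in> S\<close>
      by (intro mult_left_mono order_trans[OF assms(2)] infnorm_le_norm) auto
    finally show "dist (f x) (f y) \<le> sqrt DIM('b) * C * dist x y"
      by (simp add: dist_norm mult_ac)
  qed (use assms in auto)
qed

section \<open>Normalizing a regular cluster\<close>

lemma half_width_pos:
  fixes F :: "'d::{finite,linorder} signal"
  assumes "CARD('d) \<ge> 2" "F \<in> signals"
  shows "0 < half_width F"
proof -
  \<comment> \<open>Equal extremes would squeeze all indices into one; this is where d \<ge> 2
    enters.\<close>
  have "Min (UNIV :: 'd set) \<noteq> Max UNIV"
  proof
    assume "Min (UNIV :: 'd set) = Max UNIV"
    then have "UNIV = {Max (UNIV :: 'd set)}"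
      by (metis Max_ge Min_le UNIV_I UNIV_eq_I finite_class.finite_UNIV order_antisym singletonI)
    then have "CARD('d) = card {Max (UNIV :: 'd set)}"
      by (rule arg_cong)
    with assms(1) show False by simp
  qed
  then have "Min (UNIV :: 'd set) < Max UNIV"
    by (simp add: order.not_eq_order_implies_strict)
  then show ?thesis
    using assms(2) by (simp add: half_width_def signals_def strict_mono_def)
qed

text \<open>The extreme nodes are \<open>\<kappa> - h\<close> and \<open>\<kappa> + h\<close>, which
  go to -1 and 1, and gaps of at least \<open>\<eta> * h\<close> are stretched by
  \<open>1 / h\<close>.\<close>

lemma regular_signal_normalized_cluster:
  assumes "regular_cluster h \<kappa> \<eta> m M F" "0 < h"
  shows "regular_signal \<eta> m M (affine_nodes (1 / h) (- \<kappa> / h) F)"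
proof -
  have F: "F \<in> signals"
    and h: "h = half_width F" and \<kappa>: "\<kappa> = center F"
    using assms(1) by (auto simp: regular_cluster_def)
  have mono: "mono (\<lambda>j. nodes F $ j)"
    using F by (auto simp: signals_def intro: strict_mono_mono)
  have "\<kappa> - h \<le> nodes F $ j" "nodes F $ j \<le> \<kappa> + h" for j
    using monoD[OF mono, of "Min UNIV" j] monoD[OF mono, of j "Max UNIV"]
    by (simp_all add: h \<kappa> half_width_def center_def field_simps)
  then have "\<forall>j. nodes (affine_nodes (1 / h) (- \<kappa> / h) F) $ j \<in> {-1..1}"
    using \<open>0 < h\<close> by (simp add: field_simps)
  moreover have "\<eta> \<le> nodes (affine_nodes (1 / h) (- \<kappa> / h) F) $ j
      - nodes (affine_nodes (1 / h) (- \<kappa> / h) F) $ i" if "next_index i j" for i j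
  proof -
    have "\<eta> * h \<le> nodes F $ j - nodes F $ i"
      using assms(1) that unfolding regular_cluster_def by blast
    then show ?thesis
      using \<open>0 < h\<close> by (simp add: field_simps)
  qed
  ultimately show ?thesis
    using assms F
    by (auto simp: regular_signal_def regular_cluster_def intro: affine_nodes_in_signals)
qed

section \<open>Error bounds and attainment of the worst case\<close>

theorem theorem6p1:
  fixes F :: "'d::{finite,linorder} signal"
    and h \<kappa> \<eta> m M R C\<^sub>3 C\<^sub>4 \<epsilon> :: real
  assumes "CARD('d) \<ge> 2"
    and "0 < m" and "m \<le> M" and "0 < \<eta>"
    and "0 < R" and "0 < C\<^sub>3" and "0 < C\<^sub>4"
    and constants: "\<And>G :: 'd signal. regular_signal \<eta> m M G \<Longrightarrow> bilipschitz_inverse_at R C\<^sub>3 C\<^sub>4 G"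
    and "regular_cluster h \<kappa> \<eta> m M F"
    and "0 < \<epsilon>" and "\<epsilon> \<le> (h / (1 + \<bar>\<kappa>\<bar>)) ^ (2 * CARD('d) - 1) * R"
  shows "worst_error F \<epsilon> \<le> C\<^sub>4 * ((1 + \<bar>\<kappa>\<bar>) / h) ^ (2 * CARD('d) - 1) * \<epsilon>
    \<and> worst_amp_error F \<epsilon> \<le> C\<^sub>4 * ((1 + \<bar>\<kappa>\<bar>) / h) ^ (2 * CARD('d) - 1) * \<epsilon>
    \<and> worst_node_error F \<epsilon> \<le> C\<^sub>4 * ((1 + \<bar>\<kappa>\<bar>) / h) ^ (2 * CARD('d) - 1) * h * \<epsilon>"
proof -
  have F: "F \<in> signals" and "h = half_width F" and "h \<le> 1 / 2"
    using assms(9) by (auto simp: regular_cluster_def)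
  then have h: "0 < h"
    using half_width_pos assms(1) by blast
  define T :: "'d signal \<Rightarrow> 'd signal" where "T = affine_nodes (1 / h) (- \<kappa> / h)"
  define T' :: "'d signal \<Rightarrow> 'd signal" where "T' = affine_nodes h \<kappa>"
  define G where "G = T F"
  \<comment> \<open>\<open>K\<close> will bound the perturbation of the normalized moments. The
    assumption on \<open>\<epsilon>\<close> amounts to \<open>K \<le> R\<close>, the two bases being
    reciprocal.\<close>
  define K where "K = ((1 + \<bar>\<kappa>\<bar>) / h) ^ (2 * CARD('d) - 1) * \<epsilon>"
  have T'T [simp]: "T' (T F') = F'" for F' :: "'d signal"
    using h by (simp add: T_def T'_def affine_nodes_compose)
  have T_signals: "T F' \<in> signals" "T' F' \<in> signals" if "F' \<in> signals" for F' :: "'d signal"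
    using that h by (simp_all add: T_def T'_def affine_nodes_in_signals)
  have K: "K \<le> R"
    using assms(11) h by (simp add: K_def power_divide field_simps)

  have bilip: "bilipschitz_inverse_at R C\<^sub>3 C\<^sub>4 G"
    using constants regular_signal_normalized_cluster[OF assms(9) h] by (simp add: G_def T_def)
  \<comment> \<open>\<open>PM_inv\<close> merely chooses a preimage; uniqueness over the cube makes
    it a true inverse there.\<close>
  have unique: "\<exists>!F. F \<in> signals \<and> PM F = \<nu>" if "\<nu> \<in> cube R (PM G)" for \<nu>
    using bilip that by (simp add: bilipschitz_inverse_at_def)
  have PM_inv_signals: "PM_inv \<nu> \<in> signals" if "\<nu> \<in> cube R (PM G)" for \<nu>
    using unique[OF that] unfolding PM_inv_def by (auto intro: inv_into_into)
  have PM_inv_PM: "PM_inv (PM F') = F'" if "F' \<in> signals" "PM F' \<in> cube R (PM G)" for F'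
    using unique[OF that(2)] that(1) unfolding PM_inv_def
    by (metis f_inv_into_f imageI inv_into_into)
  have lip: "infnorm (PM_inv \<nu>'' - PM_inv \<nu>') \<le> C\<^sub>4 * infnorm (\<nu>'' - \<nu>')"
    if "\<nu>' \<in> cube R (PM G)" "\<nu>'' \<in> cube R (PM G)" for \<nu>' \<nu>'' :: "real ^ 'd bit0"
    using bilip that by (simp add: bilipschitz_inverse_at_def)
  have PM_G: "PM G \<in> cube R (PM G)"
    using \<open>0 < R\<close> by (simp add: cube_def infnorm_0)

  have PM_T: "infnorm (PM (T F') - PM G) \<le> K" if "F' \<in> error_set \<epsilon> F" for F'
  proof (rule infnorm_PM_diff_le)
    fix k assume k: "k \<le> 2 * CARD('d) - 1"
    have "\<bar>moment k (T F') - moment k G\<bar> \<le> (\<bar>1 / h\<bar> + \<bar>- \<kappa> / h\<bar>) ^ k * \<epsilon>"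
      unfolding G_def T_def using that k
      by (intro moment_affine_nodes_diff_le) (simp add: error_set_def)
    also have "\<bar>1 / h\<bar> + \<bar>- \<kappa> / h\<bar> = (1 + \<bar>\<kappa>\<bar>) / h"
      using h by (simp add: add_divide_distrib)
    \<comment> \<open>As \<open>h \<le> 1 / 2\<close>, the base is at least 1, so the top order
      \<open>2 * CARD('d) - 1\<close> is the worst.\<close>
    also have "((1 + \<bar>\<kappa>\<bar>) / h) ^ k * \<epsilon> \<le> K"
      unfolding K_def using h \<open>h \<le> 1 / 2\<close> k \<open>0 < \<epsilon>\<close>
      by (intro mult_right_mono power_increasing) auto
    finally show "\<bar>moment k (T F') - moment k G\<bar> \<le> K" .
  qed
  then have PM_T_cube: "PM (T F') \<in> cube R (PM G)" if "F' \<in> error_set \<epsilon> F" for F'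
    using that K by (fastforce simp: cube_def)
  have error_signals: "F' \<in> signals" if "F' \<in> error_set \<epsilon> F" for F'
    using that by (simp add: error_set_def)

  \<comment> \<open>Apply the Lipschitz bound to \<open>PM G\<close> and \<open>PM (T F')\<close>,
    whose inverse images are \<open>G\<close> and \<open>T F'\<close>.\<close>
  have T_error: "infnorm (T F' - G) \<le> C\<^sub>4 * K" if "F' \<in> error_set \<epsilon> F" for F'
  proof -
    have "infnorm (T F' - G) \<le> C\<^sub>4 * infnorm (PM (T F') - PM G)"
      using lip[OF PM_G PM_T_cube[OF that]] T_signals(1) error_signals[OF that] F PM_T_cube[OF that] PM_G
      by (simp add: PM_inv_PM G_def)
    also have "\<dots> \<le> C\<^sub>4 * K"
      using PM_T[OF that] \<open>0 < C\<^sub>4\<close> by simp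
    finally show ?thesis .
  qed
  have amp_error: "infnorm (amps F' - amps F) \<le> C\<^sub>4 * K" if "F' \<in> error_set \<epsilon> F" for F'
    using T_error[OF that] by (simp add: infnorm_signal[of "T F' - G"]) (simp add: G_def T_def)
  have node_error: "infnorm (nodes F' - nodes F) \<le> h * (C\<^sub>4 * K)" if "F' \<in> error_set \<epsilon> F" for F'
  proof -
    \<comment> \<open>The shift cancels in the difference and only the dilation remains: the source
      of the extra factor \<open>h\<close>.\<close>
    have "nodes F' - nodes F = h *\<^sub>R nodes (T F' - G)"
      using h by (simp add: vec_eq_iff G_def T_def field_simps)
    then have "infnorm (nodes F' - nodes F) = h * infnorm (nodes (T F' - G))"
      using h by (simp add: infnorm_mul)
    also have "\<dots> \<le> h * (C\<^sub>4 * K)"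
      using h T_error[OF that] by (intro mult_left_mono) (simp_all add: infnorm_signal)
    finally show ?thesis .
  qed
  have error: "infnorm (F' - F) \<le> C\<^sub>4 * K" if "F' \<in> error_set \<epsilon> F" for F'
  proof -
    have "0 \<le> C\<^sub>4 * K"
      using h \<open>0 < \<epsilon>\<close> \<open>0 < C\<^sub>4\<close> by (simp add: K_def)
    then have "h * (C\<^sub>4 * K) \<le> C\<^sub>4 * K"
      using h \<open>h \<le> 1 / 2\<close> mult_left_le_one_le by fastforce
    then show ?thesis
      using amp_error[OF that] node_error[OF that] by (simp add: infnorm_signal[of "F' - F"])
  qed

  \<comment> \<open>\<open>signals\<close> is not closed: in a limit, nodes may merge or amplitudes
    vanish. Compactness is therefore obtained in moment space, where \<open>S\<close> collects the
    vectors of the cube whose rescaled preimages meet the error constraints.\<close>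
  define S where "S = {\<nu> \<in> cube R (PM G).
    \<forall>k\<in>{0..2 * CARD('d) - 1}. \<bar>moment k (T' (PM_inv \<nu>)) - moment k F\<bar> \<le> \<epsilon>}"
  have cont: "continuous_on (cube R (PM G)) PM_inv"
    using \<open>0 < C\<^sub>4\<close> lip by (rule continuous_on_of_infnorm_lipschitz)
  have "closed S"
  proof -
    have "closed (cube R (PM G) \<inter> (\<lambda>\<nu>. \<bar>moment k (T' (PM_inv \<nu>)) - moment k F\<bar>) -` {..\<epsilon>})" for k
      unfolding T'_def
      by (rule continuous_closed_preimage)
        (intro continuous_intros cont compact_imp_closed compact_cube closed_atMost)+
    moreover have "S = (\<Inter>k\<in>{0..2 * CARD('d) - 1}.
        cube R (PM G) \<inter> (\<lambda>\<nu>. \<bar>moment k (T' (PM_inv \<nu>)) - moment k F\<bar>) -` {..\<epsilon>})"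
      by (auto simp: S_def)
    ultimately show ?thesis
      by (simp only:) (intro closed_INT ballI)
  qed
  moreover have "S \<subseteq> cube R (PM G)"
    by (auto simp: S_def)
  ultimately have "compact S"
    using compact_Int_closed[OF compact_cube, of S R "PM G"] by (simp add: Int_absorb1)
  \<comment> \<open>Each \<open>F'\<close> in the error set comes from \<open>PM (T F')\<close>,
    which \<open>PM_T_cube\<close> places in the cube, so the image misses no admissible
    signal.\<close>
  moreover have "error_set \<epsilon> F = (\<lambda>\<nu>. T' (PM_inv \<nu>)) ` S"
  proof (intro equalityI subsetI)
    fix F' assume F': "F' \<in> error_set \<epsilon> F"
    have eq: "T' (PM_inv (PM (T F'))) = F'"
      using PM_T_cube[OF F'] error_signals[OF F'] by (simp add: PM_inv_PM T_signals)
    moreover have "PM (T F') \<in> S"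
      using F' PM_T_cube[OF F'] by (simp add: S_def eq error_set_def)
    ultimately show "F' \<in> (\<lambda>\<nu>. T' (PM_inv \<nu>)) ` S"
      by force
  qed (auto simp: S_def error_set_def intro!: T_signals PM_inv_signals)
  ultimately have compact: "compact (error_set \<epsilon> F)"
    unfolding T'_def
    by (auto intro!: compact_continuous_image continuous_intros
        intro: continuous_on_subset[OF cont \<open>S \<subseteq> _\<close>])
  have "F \<in> error_set \<epsilon> F"
    using F \<open>0 < \<epsilon>\<close> by (simp add: error_set_def)
  then have nonempty: "error_set \<epsilon> F \<noteq> {}"
    by blast
  have "worst_error F \<epsilon> \<le> C\<^sub>4 * K"
    unfolding worst_error_def
    by (intro Greatest_le_of_compact compact nonempty continuous_intros error)
  moreover have "worst_amp_error F \<epsilon> \<le> C\<^sub>4 * K"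
    unfolding worst_amp_error_def
    by (intro Greatest_le_of_compact compact nonempty continuous_intros amp_error)
  moreover have "worst_node_error F \<epsilon> \<le> h * (C\<^sub>4 * K)"
    unfolding worst_node_error_def
    by (intro Greatest_le_of_compact compact nonempty continuous_intros node_error)
  ultimately show ?thesis
    by (simp add: K_def mult_ac)
qed

end
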